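(* Let $G_1=(V,D_1)$ and $G_2=(V,D_2)$ be two different (i.e. $D_1\neq D_2$) simple directed graphs on the same node set $V$, neither of which is complete and both of which are transitive triangle-free. Then $G_1$ and $G_2$ have different Jacobian matroids.
   Context: A directed graph $G=(V,D)$ has a finite node set $V$ and edge set $D\subseteq V\times V$ of ordered pairs $(i,j)$, $i\neq j$. It is simple if $(i,j)$ and $(j,i)$ are never both in $D$. It is complete if every pair of distinct nodes is adjacent. $\mathrm{ch}(i)$ denotes the set of children of $i$. A transitive triangle (shielded collider) is a triple of nodes $i,j,k$ with $i\to k$, $j\to k$, and $i,j$ adjacent (either $i\to j$ or $j\to i$). A graph is transitive triangle-free if it has none. Equivalently, for all $j\in V$ and all $i\in\mathrm{ch}(j)$ we have $\mathrm{ch}(j)\cap\mathrm{ch}(i)=\emptyset$. For $G=(V,D)$ let $\Lambda$ be the $V\times V$ matrix with indeterminate entries $\lambda_{ij}$ for $(i,j)\in D$ and zeros elsewhere, and $s$ a further indeterminate. Let $\psi_G(\Lambda,s)=s(I-\Lambda)(I-\Lambda)^T=K$. The transposed Jacobian $J(\psi_G)$ has rows indexed by $\{\lambda_{kl}:(k,l)\in D\}\cup\{s\}$ and columns indexed by entries $K_{ij}$, $i\le j$. Its entry in row $\theta$, column $K_{ij}$ is $\partial K_{ij}/\partial\theta$. The Jacobian matroid of $G$ is the matroid on the columns in which a set is independent iff its columns are linearly independent over $\mathbb{R}(\lambda,s)$. *)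

theory Defs
  imports Complex_Main "HOL-Library.Poly_Mapping" "HOL-Computational_Algebra.Fraction_Field"
    "HOL-Library.Option_ord" "HOL-Library.Product_Lexorder"
begin

definition digraph :: "'a set \<Rightarrow> ('a \<times> 'a) set \<Rightarrow> bool" where
  "digraph V D \<longleftrightarrow> finite V \<and> D \<subseteq> V \<times> V \<and> (\<forall>(i,j)\<in>D. i \<noteq> j)"

definition simple_digraph :: "('a \<times> 'a) set \<Rightarrow> bool" where
  "simple_digraph D \<longleftrightarrow> (\<forall>i j. (i,j) \<in> D \<longrightarrow> (j,i) \<notin> D)"

definition adjacent :: "('a \<times> 'a) set \<Rightarrow> 'a \<Rightarrow> 'a \<Rightarrow> bool" where
  "adjacent D i j \<longleftrightarrow> (i,j) \<in> D \<or> (j,i) \<in> D"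

definition complete_digraph :: "'a set \<Rightarrow> ('a \<times> 'a) set \<Rightarrow> bool" where
  "complete_digraph V D \<longleftrightarrow> (\<forall>i\<in>V. \<forall>j\<in>V. i \<noteq> j \<longrightarrow> adjacent D i j)"

definition transitive_triangle_free :: "('a \<times> 'a) set \<Rightarrow> bool" where
  "transitive_triangle_free D \<longleftrightarrow>
     \<not> (\<exists>i j k. (i,k) \<in> D \<and> (j,k) \<in> D \<and> adjacent D i j)"

text \<open>Variables: Some (k,l) is lambda_kl, None is s.\<close>
type_synonym 'a var = "('a \<times> 'a) option"
type_synonym 'a mpoly = "('a var \<Rightarrow>\<^sub>0 nat) \<Rightarrow>\<^sub>0 real"

definition Var :: "'a var \<Rightarrow> 'a mpoly" where
  "Var v = Poly_Mapping.single (Poly_Mapping.single v 1) 1"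

definition Const :: "real \<Rightarrow> 'a mpoly" where
  "Const c = Poly_Mapping.single 0 c"

definition pdiff :: "'a var \<Rightarrow> 'a mpoly \<Rightarrow> 'a mpoly" where
  "pdiff v p = (\<Sum>m\<in>Poly_Mapping.keys p.
      Poly_Mapping.single (m - Poly_Mapping.single v (1::nat))
        (real (Poly_Mapping.lookup m v) * Poly_Mapping.lookup p m))"

definition Lam :: "('a \<times> 'a) set \<Rightarrow> 'a \<Rightarrow> 'a \<Rightarrow> 'a mpoly" where
  "Lam D i j = (if (i,j) \<in> D then Var (Some (i,j)) else 0)"

definition IminusLam :: "('a \<times> 'a) set \<Rightarrow> 'a \<Rightarrow> 'a \<Rightarrow> 'a mpoly" where
  "IminusLam D i j = (if i = j then Const 1 else 0) - Lam D i j"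

definition Kmat :: "'a set \<Rightarrow> ('a \<times> 'a) set \<Rightarrow> 'a \<Rightarrow> 'a \<Rightarrow> 'a mpoly" where
  "Kmat V D i j = Var None * (\<Sum>k\<in>V. IminusLam D i k * IminusLam D j k)"

definition jac_rows :: "('a \<times> 'a) set \<Rightarrow> 'a var set" where
  "jac_rows D = Some ` D \<union> {None}"

definition jac_cols :: "'a::linorder set \<Rightarrow> ('a \<times> 'a) set" where
  "jac_cols V = {(i,j). i \<in> V \<and> j \<in> V \<and> i \<le> j}"

definition jac_entry :: "'a set \<Rightarrow> ('a \<times> 'a) set \<Rightarrow> 'a var \<Rightarrow> 'a \<times> 'a \<Rightarrow> 'a mpoly" where
  "jac_entry V D \<theta> c = pdiff \<theta> (Kmat V D (fst c) (snd c))"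

definition jac_indep :: "'a::linorder set \<Rightarrow> ('a \<times> 'a) set \<Rightarrow> ('a \<times> 'a) set \<Rightarrow> bool" where
  "jac_indep V D S \<longleftrightarrow> S \<subseteq> jac_cols V \<and>
     (\<forall>a :: 'a \<times> 'a \<Rightarrow> 'a mpoly fract.
        (\<forall>\<theta>\<in>jac_rows D. (\<Sum>c\<in>S. a c * Fract (jac_entry V D \<theta> c) 1) = 0)
        \<longrightarrow> (\<forall>c\<in>S. a c = 0))"

definition jacobian_matroid :: "'a::linorder set \<Rightarrow> ('a \<times> 'a) set \<Rightarrow> ('a \<times> 'a) set set" where
  "jacobian_matroid V D = {S. jac_indep V D S}"

end

theory Submission
  imports Defs "HOL-Library.Function_Algebras" "HOL-Computational_Algebra.Polynomial_Factorial"
begin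

text \<open>The orientation of every edge is read off from matroid closures of principal submatrices.
  Let \<open>U q\<close> be the space of vectors that vanish on all rows \<open>\<lambda>\<^sub>q\<^sub>l\<close>; it contains every column
  \<open>K\<^sub>i\<^sub>j\<close> with \<open>i, j \<noteq> q\<close>. If \<open>p \<rightarrow> q\<close> and there are at least three nodes, then the column \<open>K\<^sub>p\<^sub>q\<close> lies
  in the span of the columns \<open>K\<^sub>i\<^sub>j\<close> with \<open>i, j \<noteq> q\<close>. If \<open>p \<rightarrow> q\<close> is not an edge, then either \<open>K\<^sub>p\<^sub>q\<close> is
  zero, or \<open>q \<rightarrow> p\<close> or \<open>p\<close> and \<open>q\<close> have a common child; in the latter two cases \<open>K\<^sub>p\<^sub>q\<close> is not in \<open>U q\<close>,
  hence not in that span.\<close>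

section \<open>Formal partial derivatives and the product rule\<close>

text \<open>Monomials outside the support contribute zero, so several polynomials can be
  differentiated over one common index set.\<close>

lemma pdiff_superset:
  assumes "finite M" "Poly_Mapping.keys p \<subseteq> M"
  shows "pdiff v p = (\<Sum>m\<in>M. Poly_Mapping.single (m - Poly_Mapping.single v 1)
      (real (Poly_Mapping.lookup m v) * Poly_Mapping.lookup p m))"
  unfolding pdiff_def
  by (rule sum.mono_neutral_left) (use assms in \<open>auto simp: in_keys_iff\<close>)

lemma pdiff_single:
  "pdiff v (Poly_Mapping.single m c) =
    Poly_Mapping.single (m - Poly_Mapping.single v 1) (real (Poly_Mapping.lookup m v) * c)"
  by (subst pdiff_superset[of "{m}"]) auto

lemma pdiff_0 [simp]: "pdiff v 0 = 0"
  by (simp add: pdiff_def)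

lemma pdiff_add: "pdiff v (p + q) = pdiff v p + pdiff v q"
proof -
  let ?M = "Poly_Mapping.keys p \<union> Poly_Mapping.keys q"
  have "Poly_Mapping.keys (p + q) \<subseteq> ?M"
    by (rule Poly_Mapping.keys_add)
  then show ?thesis
    by (simp add: pdiff_superset[of ?M] lookup_add distrib_left single_add sum.distrib)
qed

lemma pdiff_uminus: "pdiff v (- p) = - pdiff v p"
  using pdiff_add[of v p "- p"] by (simp add: eq_neg_iff_add_eq_0 add.commute)

lemma pdiff_diff: "pdiff v (p - q) = pdiff v p - pdiff v q"
  using pdiff_add[of v p "- q"] by (simp add: pdiff_uminus)

lemma pdiff_sum: "pdiff v (\<Sum>i\<in>A. f i) = (\<Sum>i\<in>A. pdiff v (f i))"
  by (induction A rule: infinite_finite_induct) (simp_all add: pdiff_add)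

text \<open>Reduces additive and bilinear identities, such as the product rule, to single
  monomials.\<close>

lemma mpoly_induct [case_names single add]:
  fixes p :: "'a mpoly"
  assumes "\<And>m c. P (Poly_Mapping.single m c)" "\<And>p q. P p \<Longrightarrow> P q \<Longrightarrow> P (p + q)"
  shows "P p"
proof (induction p rule: update_induct)
  case const
  then show ?case using assms(1)[of 0 0] by simp
next
  case (update p m c)
  have "Poly_Mapping.update m c p = p + Poly_Mapping.single m c"
    using update(1)
    by (intro poly_mapping_eqI) (auto simp: lookup_update lookup_add lookup_single in_keys_iff when_def)
  then show ?case using assms update by simp
qed

lemma pdiff_mult_single:
  fixes m n :: "'a var \<Rightarrow>\<^sub>0 nat"
  shows "pdiff v (Poly_Mapping.single m c * Poly_Mapping.single n d) =
    pdiff v (Poly_Mapping.single m c) * Poly_Mapping.single n d +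
    Poly_Mapping.single m c * pdiff v (Poly_Mapping.single n d)"
proof -
  let ?v = "Poly_Mapping.single v (1::nat)"
  \<comment> \<open>Subtraction of exponents is truncated, so the shift can fail if \<open>v\<close>
    does not occur in \<open>a\<close>; in that case the coefficient of the term is zero
    anyway.\<close>
  have shift: "a + b - ?v = (a - ?v) + b" if "Poly_Mapping.lookup a v \<noteq> 0" for a b :: "'a var \<Rightarrow>\<^sub>0 nat"
    using that
    by (intro poly_mapping_eqI) (auto simp: lookup_add lookup_minus lookup_single when_def)
  have left: "Poly_Mapping.single (m + n - ?v) (real (Poly_Mapping.lookup m v) * (c * d)) =
      Poly_Mapping.single (m - ?v + n) (real (Poly_Mapping.lookup m v) * (c * d))"
    using shift[of m n] by (cases "Poly_Mapping.lookup m v = 0") simp_all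
  have right: "Poly_Mapping.single (m + n - ?v) (real (Poly_Mapping.lookup n v) * (c * d)) =
      Poly_Mapping.single (m + (n - ?v)) (real (Poly_Mapping.lookup n v) * (c * d))"
    using shift[of n m] by (cases "Poly_Mapping.lookup n v = 0") (simp_all add: add.commute)
  have "pdiff v (Poly_Mapping.single m c * Poly_Mapping.single n d) =
      Poly_Mapping.single (m + n - ?v) (real (Poly_Mapping.lookup m v) * (c * d)) +
      Poly_Mapping.single (m + n - ?v) (real (Poly_Mapping.lookup n v) * (c * d))"
    by (simp add: mult_single pdiff_single lookup_add distrib_right single_add)
  also have "\<dots> = pdiff v (Poly_Mapping.single m c) * Poly_Mapping.single n d +
      Poly_Mapping.single m c * pdiff v (Poly_Mapping.single n d)"
    unfolding left right by (simp add: mult_single pdiff_single mult_ac add_ac)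
  finally show ?thesis .
qed

lemma pdiff_mult: "pdiff v (p * q) = pdiff v p * q + p * pdiff v q"
proof (induction p rule: mpoly_induct)
  case (single m c)
  show ?case
  proof (induction q rule: mpoly_induct)
    case (single n d)
    show ?case by (rule pdiff_mult_single)
  next
    case (add q q')
    then show ?case by (simp add: distrib_left pdiff_add)
  qed
next
  case (add p p')
  then show ?case by (simp add: distrib_right pdiff_add)
qed

lemma Const_1 [simp]: "Const 1 = 1"
  by (simp add: Const_def)

lemma pdiff_1 [simp]: "pdiff v 1 = 0"
  by (simp add: pdiff_single flip: single_one)

lemma pdiff_Var: "pdiff v (Var w) = (if v = w then 1 else 0)"
  by (auto simp: Var_def pdiff_single lookup_single)

lemma pdiff_Lam:
  "pdiff \<theta> (Lam D i k) = (if \<theta> = Some (i, k) \<and> (i, k) \<in> D then 1 else 0)"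
  by (auto simp: Lam_def pdiff_Var)

lemma pdiff_IminusLam:
  "pdiff \<theta> (IminusLam D i k) = (if \<theta> = Some (i, k) \<and> (i, k) \<in> D then - 1 else 0)"
  by (auto simp: IminusLam_def pdiff_diff pdiff_Lam)

section \<open>Entries of the Jacobian\<close>

lemma jac_entry_scale:
  "jac_entry V D None (i, j) = (\<Sum>k\<in>V. IminusLam D i k * IminusLam D j k)"
  by (simp add: jac_entry_def Kmat_def pdiff_mult pdiff_Var pdiff_sum pdiff_IminusLam)

text \<open>The product rule differentiates either factor of \<open>K_ij\<close>; for
  \<open>i = j\<close> both summands contribute.\<close>

lemma jac_entry_edge:
  assumes "finite V" "D \<subseteq> V \<times> V"
  shows "jac_entry V D (Some (a, b)) (i, j) = (if (a, b) \<in> D then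
      - Var None * ((if a = i then IminusLam D j b else 0) + (if a = j then IminusLam D i b else 0)) else 0)"
proof -
  have eq: "(\<Sum>k\<in>V. pdiff (Some (a, b)) (IminusLam D x k) * IminusLam D y k) =
      (if (a, b) \<in> D \<and> a = x then - IminusLam D y b else 0)" for x y
  proof -
    have "(\<Sum>k\<in>V. pdiff (Some (a, b)) (IminusLam D x k) * IminusLam D y k) =
        (\<Sum>k\<in>V. if k = b then (if (a, b) \<in> D \<and> a = x then - IminusLam D y b else 0) else 0)"
      by (rule sum.cong) (auto simp: pdiff_IminusLam)
    then show ?thesis using assms by auto
  qed
  have "jac_entry V D (Some (a, b)) (i, j) = Var None *
     ((\<Sum>k\<in>V. pdiff (Some (a, b)) (IminusLam D i k) * IminusLam D j k) +
      (\<Sum>k\<in>V. pdiff (Some (a, b)) (IminusLam D j k) * IminusLam D i k))"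
    by (simp add: jac_entry_def Kmat_def pdiff_mult pdiff_Var pdiff_sum sum.distrib mult.commute)
  then show ?thesis unfolding eq by (auto simp: algebra_simps)
qed

lemma sum_IminusLam:
  assumes "finite V" "i \<in> V" "j \<in> V"
  shows "(\<Sum>k\<in>V. IminusLam D i k * IminusLam D j k) =
    (if i = j then 1 else 0) - Lam D i j - Lam D j i + (\<Sum>k\<in>V. Lam D i k * Lam D j k)"
proof -
  have "(\<Sum>k\<in>V. IminusLam D i k * IminusLam D j k) =
     (\<Sum>k\<in>V. (if k = i then (if i = j then 1 else 0) else 0)
        - (if k = j then Lam D i j else 0) - (if k = i then Lam D j i else 0) + Lam D i k * Lam D j k)"
    by (rule sum.cong) (auto simp: IminusLam_def algebra_simps)
  then show ?thesis using assms by (simp add: sum.distrib sum_subtractf)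
qed

section \<open>Nonvanishing of the coefficients used as divisors\<close>

lemma Var_neq_0 [simp]: "Var v \<noteq> 0"
  by (metis Var_def lookup_single_eq lookup_zero zero_neq_one)

lemma lookup_Lam_sq_0: "Poly_Mapping.lookup (Lam D i k * Lam D i k) 0 = 0"
proof -
  have "Poly_Mapping.single v (1::nat) + Poly_Mapping.single v 1 \<noteq> 0" for v :: "'a var"
    by (metis add_is_0 lookup_add lookup_single_eq lookup_zero zero_neq_one)
  then show ?thesis
    by (simp add: Lam_def Var_def mult_single lookup_single_not_eq)
qed

text \<open>The squares have no constant term, so the constant coefficient is 1.\<close>

lemma one_minus_Lam_sq_neq_0: "1 - (\<Sum>k\<in>V. Lam D i k * Lam D i k) \<noteq> 0"
proof -
  have "Poly_Mapping.lookup (1 - (\<Sum>k\<in>V. Lam D i k * Lam D i k)) 0 = 1"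
    by (simp add: lookup_minus lookup_sum lookup_Lam_sq_0)
  then show ?thesis by auto
qed

text \<open>The square of \<open>v\<close> has coefficient 1, or 2 if \<open>v = w\<close>.\<close>

lemma Var_sq_add_Var_sq_neq_0: "Var v * Var v + Var w * Var w \<noteq> (0 :: 'a mpoly)"
proof -
  let ?m = "Poly_Mapping.single v (1::nat) + Poly_Mapping.single v 1"
  have "Poly_Mapping.lookup (Var v * Var v + Var w * Var w :: 'a mpoly) ?m \<ge> 1"
    by (simp add: Var_def mult_single lookup_add lookup_single when_def)
  then show ?thesis by (metis lookup_zero not_one_le_zero)
qed

lemma to_fract_sum [simp]: "to_fract (sum f A) = (\<Sum>a\<in>A. to_fract (f a))"
  by (induction A rule: infinite_finite_induct) simp_all

section \<open>Columns as vectors, spans and independence\<close>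

interpretation fun_space: vector_space "\<lambda>(k::'f::field) (f::'v \<Rightarrow> 'f) x. k * f x"
  by unfold_locales (auto simp: fun_eq_iff algebra_simps)

text \<open>Defined on all variables, so that the ambient space is the same for every graph; entries
  outside \<open>jac_rows D\<close> vanish and leave the linear relations unchanged.\<close>

definition jac_col :: "'a::linorder set \<Rightarrow> ('a \<times> 'a) set \<Rightarrow> 'a \<times> 'a \<Rightarrow> 'a var \<Rightarrow> 'a mpoly fract" where
  "jac_col V D c \<theta> = to_fract (jac_entry V D \<theta> c)"

lemma jac_entry_not_row:
  assumes "finite V" "D \<subseteq> V \<times> V" "\<theta> \<notin> jac_rows D"
  shows "jac_entry V D \<theta> c = 0"
proof (cases \<theta>)
  case None
  then show ?thesis using assms by (simp add: jac_rows_def)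
next
  case (Some e)
  then show ?thesis using assms
    by (cases c; cases e) (auto simp: jac_rows_def jac_entry_edge)
qed

lemma sum_fun_apply: "(\<Sum>c\<in>S. f c) \<theta> = (\<Sum>c\<in>S. f c \<theta>)"
  for f :: "'c \<Rightarrow> 'v \<Rightarrow> 'f::comm_monoid_add"
  by (induction S rule: infinite_finite_induct) auto

lemma jac_indep_iff:
  assumes "finite V" "D \<subseteq> V \<times> V"
  shows "jac_indep V D S \<longleftrightarrow> S \<subseteq> jac_cols V \<and>
     (\<forall>a. (\<Sum>c\<in>S. (\<lambda>\<theta>. a c * jac_col V D c \<theta>)) = 0 \<longrightarrow> (\<forall>c\<in>S. a c = 0))"
proof -
  have "(\<forall>\<theta>\<in>jac_rows D. (\<Sum>c\<in>S. a c * Fract (jac_entry V D \<theta> c) 1) = 0) \<longleftrightarrow>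
      (\<Sum>c\<in>S. (\<lambda>\<theta>. a c * jac_col V D c \<theta>)) = 0" for a
  proof -
    have "(\<Sum>c\<in>S. a c * jac_col V D c \<theta>) = 0" if "\<theta> \<notin> jac_rows D" for \<theta>
      using jac_entry_not_row[OF assms that] by (simp add: jac_col_def)
    then show ?thesis
      by (auto simp: fun_eq_iff sum_fun_apply jac_col_def to_fract_def)
  qed
  then show ?thesis by (simp add: jac_indep_def)
qed

text \<open>Turns membership in a span into a statement about independent sets alone, which carries
  over to any graph with the same matroid. \<open>S\<close> indexes a basis of the columns in
  \<open>A\<close>.\<close>

lemma jac_span_imp_dependent:
  assumes V: "finite V" "D \<subseteq> V \<times> V"
    and A: "A \<subseteq> jac_cols V" and c: "c \<in> jac_cols V" "c \<notin> A"
    and span: "jac_col V D c \<in> fun_space.span (jac_col V D ` A)"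
  obtains S where "S \<subseteq> A" "jac_indep V D S" "\<not> jac_indep V D (insert c S)"
proof -
  let ?col = "jac_col V D"
  have "finite A"
    by (rule finite_subset[of _ "V \<times> V"]) (use A V in \<open>auto simp: jac_cols_def\<close>)
  obtain B where B: "B \<subseteq> ?col ` A" "fun_space.independent B" "?col ` A \<subseteq> fun_space.span B"
    by (rule fun_space.maximal_independent_subset)
  \<comment> \<open>The matroid lives on index pairs but \<open>B\<close> is a set of vectors;
    \<open>S\<close> picks one index per vector, as equal columns may occur.\<close>
  obtain S where S: "S \<subseteq> A" "inj_on ?col S" "B = ?col ` S"
    using B(1) by (auto simp: subset_image_inj)
  have "finite S" "finite B" using S \<open>finite A\<close> by (auto intro: finite_subset)
  have sum_B: "(\<Sum>v\<in>B. (\<lambda>\<theta>. u v * v \<theta>)) = (\<Sum>d\<in>S. (\<lambda>\<theta>. u (?col d) * ?col d \<theta>))" for u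
    unfolding S(3) by (subst sum.reindex[OF S(2)]) simp
  have indep: "jac_indep V D S"
  proof (unfold jac_indep_iff[OF V], intro conjI allI impI ballI)
    show "S \<subseteq> jac_cols V" using S A by auto
    fix a d assume a: "(\<Sum>d\<in>S. (\<lambda>\<theta>. a d * ?col d \<theta>)) = 0" and d: "d \<in> S"
    let ?u = "\<lambda>v. a (inv_into S ?col v)"
    have "(\<Sum>v\<in>B. (\<lambda>\<theta>. ?u v * v \<theta>)) = 0"
      unfolding sum_B a[symmetric] by (rule sum.cong) (simp_all add: S(2))
    moreover have "?col d \<in> B" using d S(3) by simp
    ultimately have "?u (?col d) = 0"
      using fun_space.independentD[OF B(2) \<open>finite B\<close> subset_refl, of ?u] by simp
    then show "a d = 0" using S(2) d by simp
  qed
  have "?col c \<in> fun_space.span B"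
    using span B(3) fun_space.span_minimal fun_space.subspace_span by blast
  then obtain u where u: "?col c = (\<Sum>v\<in>B. (\<lambda>\<theta>. u v * v \<theta>))"
    by (auto simp: fun_space.span_finite[OF \<open>finite B\<close>])
  have "\<not> jac_indep V D (insert c S)"
  proof
    assume ind: "jac_indep V D (insert c S)"
    define a where "a d = (if d = c then - 1 else u (?col d))" for d
    have "c \<notin> S" using S c by auto
    then have "(\<Sum>d\<in>insert c S. (\<lambda>\<theta>. a d * ?col d \<theta>)) =
        - ?col c + (\<Sum>d\<in>S. (\<lambda>\<theta>. u (?col d) * ?col d \<theta>))"
      using \<open>finite S\<close> by (auto simp: a_def fun_eq_iff sum_fun_apply intro!: sum.cong)
    also have "\<dots> = 0" unfolding u sum_B by simp
    finally have "a c = 0" using ind unfolding jac_indep_iff[OF V] by blast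
    then show False by (simp add: a_def)
  qed
  with S(1) indep show ?thesis by (rule that)
qed

text \<open>In row \<open>\<theta>\<close> a linear relation reduces to the term of
  \<open>c\<close>, which forces its coefficient to vanish.\<close>

lemma jac_indep_insert:
  assumes "jac_indep V D S" "finite S" "c \<in> jac_cols V"
    and "\<theta> \<in> jac_rows D" "jac_entry V D \<theta> c \<noteq> 0" "\<And>d. d \<in> S \<Longrightarrow> jac_entry V D \<theta> d = 0"
  shows "jac_indep V D (insert c S)"
  unfolding jac_indep_def
proof (intro conjI allI impI)
  have "c \<notin> S" using assms(5,6) by blast
  show "insert c S \<subseteq> jac_cols V" using assms by (auto simp: jac_indep_def)
  fix a assume a: "\<forall>\<theta>\<in>jac_rows D. (\<Sum>d\<in>insert c S. a d * Fract (jac_entry V D \<theta> d) 1) = 0"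
  have "(\<Sum>d\<in>S. a d * Fract (jac_entry V D \<theta> d) 1) = 0"
    by (rule sum.neutral) (simp add: assms(6) flip: Zero_fract_def)
  then have "a c * to_fract (jac_entry V D \<theta> c) = 0"
    using a[rule_format, OF assms(4)] \<open>finite S\<close> \<open>c \<notin> S\<close> by (simp add: to_fract_def)
  then have "a c = 0" using assms(5) by simp
  then have "\<forall>\<theta>\<in>jac_rows D. (\<Sum>d\<in>S. a d * Fract (jac_entry V D \<theta> d) 1) = 0"
    using a \<open>finite S\<close> \<open>c \<notin> S\<close> by simp
  then have "\<forall>d\<in>S. a d = 0" using assms(1) by (simp add: jac_indep_def)
  with \<open>a c = 0\<close> show "\<forall>d\<in>insert c S. a d = 0" by simp
qed


section \<open>Edge columns and diagonal columns\<close>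

lemma jac_entry_commute: "jac_entry V D \<theta> (j, i) = jac_entry V D \<theta> (i, j)"
proof -
  have "Kmat V D j i = Kmat V D i j"
    unfolding Kmat_def by (intro arg_cong2[where f = "(*)"] sum.cong refl mult.commute)
  then show ?thesis by (simp add: jac_entry_def)
qed

lemma digraphD:
  assumes "digraph V D"
  shows "finite V" "D \<subseteq> V \<times> V" "(i, i) \<notin> D" "(i, j) \<in> D \<Longrightarrow> i \<in> V \<and> j \<in> V \<and> i \<noteq> j"
  using assms unfolding digraph_def by blast+

lemma transitive_triangle_freeD:
  "transitive_triangle_free D \<Longrightarrow> (i, j) \<in> D \<Longrightarrow> (i, k) \<in> D \<Longrightarrow> (j, k) \<notin> D"
  unfolding transitive_triangle_free_def adjacent_def by blast

text \<open>The nodes \<open>i\<close> and \<open>j\<close> have no common child and there is no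
  reverse edge, so \<open>K_ij\<close> is just minus the product of \<open>s\<close> and the
  variable of the edge.\<close>

lemma jac_entry_of_edge:
  assumes D: "digraph V D" "simple_digraph D" "transitive_triangle_free D" and ij: "(i, j) \<in> D"
  shows "jac_entry V D \<theta> (i, j) =
    (if \<theta> = None then - Lam D i j else if \<theta> = Some (i, j) then - Var None else 0)"
proof (cases \<theta>)
  case None
  have "(\<Sum>k\<in>V. Lam D i k * Lam D j k) = 0"
    by (rule sum.neutral) (use transitive_triangle_freeD[OF D(3) ij] in \<open>auto simp: Lam_def\<close>)
  moreover have "Lam D j i = 0" using D(2) ij by (auto simp: simple_digraph_def Lam_def)
  ultimately show ?thesis
    using None digraphD(1)[OF D(1)] digraphD(4)[OF D(1) ij]
    by (simp add: jac_entry_scale sum_IminusLam)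
next
  case (Some e)
  obtain a b where e: "e = (a, b)" by (cases e)
  have "(j, i) \<notin> D" "i \<noteq> j" using D(2) ij digraphD(4)[OF D(1) ij] by (auto simp: simple_digraph_def)
  moreover have "(i, b) \<notin> D \<or> (j, b) \<notin> D"
    using transitive_triangle_freeD[OF D(3) ij] by blast
  ultimately have "(if (a, b) \<in> D then (if a = i then IminusLam D j b else 0)
      + (if a = j then IminusLam D i b else 0) else 0) = (if e = (i, j) then 1 else 0)"
    using ij by (auto simp: e IminusLam_def Lam_def)
  then have "- Var None * (if (a, b) \<in> D then (if a = i then IminusLam D j b else 0)
      + (if a = j then IminusLam D i b else 0) else 0) = - Var None * (if e = (i, j) then 1 else 0)"
    by simp
  then show ?thesis
    using ij by (cases "(a, b) \<in> D") (auto simp: Some e jac_entry_edge[OF digraphD(1,2)[OF D(1)]])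
qed

lemma jac_entry_diag:
  assumes D: "digraph V D" and i: "i \<in> V"
  shows "jac_entry V D None (i, i) = 1 + (\<Sum>k\<in>V. Lam D i k * Lam D i k)"
    and "jac_entry V D (Some (a, b)) (i, i) = (if a = i then 2 * Var None * Lam D i b else 0)"
proof -
  show "jac_entry V D None (i, i) = 1 + (\<Sum>k\<in>V. Lam D i k * Lam D i k)"
    using digraphD(1,3)[OF D] i by (simp add: jac_entry_scale sum_IminusLam) (simp add: Lam_def)
  show "jac_entry V D (Some (a, b)) (i, i) = (if a = i then 2 * Var None * Lam D i b else 0)"
    using digraphD(3)[OF D] by (auto simp: jac_entry_edge[OF digraphD(1,2)[OF D]] IminusLam_def Lam_def algebra_simps)
qed

text \<open>Without transitive triangles the column of an edge has just two nonzero entries, so the columns of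
  the edges leaving \<open>i\<close> clear all \<open>\<lambda>\<close>-rows of the column of \<open>K\<^sub>i\<^sub>i\<close>.\<close>
lemma jac_entry_diag_relation:
  assumes D: "digraph V D" "simple_digraph D" "transitive_triangle_free D" and i: "i \<in> V"
  shows "jac_entry V D \<theta> (i, i) + (\<Sum>l\<in>V. 2 * Lam D i l * jac_entry V D \<theta> (i, l)) =
    (if \<theta> = None then 1 - (\<Sum>k\<in>V. Lam D i k * Lam D i k) else 0)"
proof -
  \<comment> \<open>For a non-edge the factor \<open>Lam D i l\<close> is zero, so the formula for
    edge columns can be used for every \<open>l\<close>.\<close>
  have *: "2 * Lam D i l * jac_entry V D \<theta> (i, l) =
      2 * Lam D i l * (if \<theta> = None then - Lam D i l else if \<theta> = Some (i, l) then - Var None else 0)" for l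
    using jac_entry_of_edge[OF D] by (cases "(i, l) \<in> D") (simp_all add: Lam_def)
  show ?thesis
  proof (cases \<theta>)
    case None
    then show ?thesis
      unfolding * by (simp add: jac_entry_diag[OF D(1) i] sum_negf mult.assoc flip: sum_distrib_left)
  next
    case (Some e)
    obtain a b where e: "e = (a, b)" by (cases e)
    have "(\<Sum>l\<in>V. 2 * Lam D i l * jac_entry V D \<theta> (i, l)) =
        (\<Sum>l\<in>V. if l = b then (if a = i then - (2 * Var None * Lam D i b) else 0) else 0)"
      unfolding * by (rule sum.cong) (auto simp: Some e)
    also have "\<dots> = (if a = i then - (2 * Var None * Lam D i b) else 0)"
      using digraphD[OF D(1)] by (auto simp: Lam_def)
    finally show ?thesis by (simp add: Some e jac_entry_diag[OF D(1) i])
  qed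
qed

section \<open>The column of an edge lies in the span of columns avoiding its head\<close>

lemma span_scaleD:
  assumes "(\<lambda>x. k * f x) \<in> fun_space.span W" "k \<noteq> 0"
  shows "f \<in> fun_space.span W"
  using fun_space.span_scale[OF assms(1), of "inverse k"] assms(2)
  by (simp flip: mult.assoc)

text \<open>Modulo the span, the diagonal relation of \<open>p\<close> makes a nonzero multiple of
  \<open>K_pq\<close> equal to a multiple of the unit vector of row \<open>s\<close>. A non-parent
  of \<open>q\<close> puts that vector in the span; if there is none, the second parent
  \<open>r\<close> supplies enough columns.\<close>

lemma jac_col_edge_in_span:
  assumes D: "digraph V D" "simple_digraph D" "transitive_triangle_free D"
    and pq: "(p, q) \<in> D" and r: "r \<in> V" "r \<noteq> p" "r \<noteq> q"
  shows "jac_col V D (p, q) \<in>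
    fun_space.span (jac_col V D ` {c \<in> jac_cols V. fst c \<noteq> q \<and> snd c \<noteq> q})"
    (is "_ \<in> ?W")
proof -
  let ?col = "jac_col V D" and ?L = "Lam D"
  let ?d = "\<lambda>i. 1 - (\<Sum>k\<in>V. ?L i k * ?L i k)"
  define e0 :: "'a var \<Rightarrow> 'a mpoly fract" where "e0 = (\<lambda>\<theta>. if \<theta> = None then 1 else 0)"
  have fin: "finite V" using D by (simp add: digraph_def)
  have p: "p \<in> V" "p \<noteq> q" and q: "q \<in> V" using digraphD(4)[OF D(1) pq] by auto
  have base: "?col (i, j) \<in> ?W" if "i \<in> V" "j \<in> V" "i \<noteq> q" "j \<noteq> q" for i j
  proof (cases "i \<le> j")
    case True
    then show ?thesis using that by (intro fun_space.span_base) (auto simp: jac_cols_def)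
  next
    case False
    have "?col (i, j) = ?col (j, i)" using jac_entry_commute[of V D _ i j] by (simp add: fun_eq_iff jac_col_def)
    then show ?thesis using that False by (auto intro!: fun_space.span_base simp: jac_cols_def)
  qed
  have rest: "?col (i, i) + (\<Sum>l\<in>V-{q}. (\<lambda>\<theta>. to_fract (2 * ?L i l) * ?col (i, l) \<theta>)) \<in> ?W"
    if "i \<in> V" "i \<noteq> q" for i
    by (intro fun_space.span_add fun_space.span_sum fun_space.span_scale base) (use that in auto)
  \<comment> \<open>This is the diagonal relation with the term \<open>l = q\<close>, the only one
    outside the span's generators, moved to the right.\<close>
  have relation: "?col (i, i) + (\<Sum>l\<in>V-{q}. (\<lambda>\<theta>. to_fract (2 * ?L i l) * ?col (i, l) \<theta>)) =
      (\<lambda>\<theta>. to_fract (?d i) * e0 \<theta>) - (\<lambda>\<theta>. to_fract (2 * ?L i q) * ?col (i, q) \<theta>)"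
    if "i \<in> V" "i \<noteq> q" for i
  proof
    fix \<theta>
    have "to_fract (jac_entry V D \<theta> (i, i) + (\<Sum>l\<in>V. 2 * ?L i l * jac_entry V D \<theta> (i, l))) =
        to_fract (?d i) * e0 \<theta>"
      unfolding jac_entry_diag_relation[OF D \<open>i \<in> V\<close>] by (simp add: e0_def)
    then have *: "to_fract (?d i) * e0 \<theta> = ?col (i, i) \<theta> + (to_fract (2 * ?L i q) * ?col (i, q) \<theta> +
        (\<Sum>l\<in>V-{q}. to_fract (2 * ?L i l) * ?col (i, l) \<theta>))"
      unfolding sum.remove[OF fin q] jac_col_def to_fract_add to_fract_sum
        to_fract_mult[of _ "jac_entry _ _ _ _"] by (rule sym)
    show "(?col (i, i) + (\<Sum>l\<in>V-{q}. (\<lambda>\<theta>. to_fract (2 * ?L i l) * ?col (i, l) \<theta>))) \<theta> =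
      ((\<lambda>\<theta>. to_fract (?d i) * e0 \<theta>) - (\<lambda>\<theta>. to_fract (2 * ?L i q) * ?col (i, q) \<theta>)) \<theta>"
      unfolding plus_fun_apply fun_diff_def sum_fun_apply * by (simp del: to_fract_mult)
  qed
  have Lpq: "?L p q = Var (Some (p, q))" using pq by (simp add: Lam_def)
  show ?thesis
  proof (cases "\<exists>m\<in>V. m \<noteq> q \<and> (m, q) \<notin> D")
    case True
    \<comment> \<open>A non-parent \<open>m\<close> of \<open>q\<close> yields the unit vector of row \<open>s\<close>, and then \<open>K\<^sub>p\<^sub>p\<close> yields \<open>K\<^sub>p\<^sub>q\<close>.\<close>
    then obtain m where m: "m \<in> V" "m \<noteq> q" "(m, q) \<notin> D" by auto
    have "(\<lambda>\<theta>. to_fract (?d m) * e0 \<theta>) \<in> ?W"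
      using rest[OF m(1,2)] unfolding relation[OF m(1,2)] using m(3)
      by (simp add: Lam_def fun_diff_def del: to_fract_diff)
    then have "e0 \<in> ?W"
      by (rule span_scaleD) (use one_minus_Lam_sq_neq_0 in \<open>simp del: to_fract_diff\<close>)
    then have "(\<lambda>\<theta>. to_fract (?d p) * e0 \<theta>) \<in> ?W" by (rule fun_space.span_scale)
    from fun_space.span_diff[OF this rest[OF p, unfolded relation[OF p]]]
    have "(\<lambda>\<theta>. to_fract (2 * ?L p q) * ?col (p, q) \<theta>) \<in> ?W" by (simp del: to_fract_mult)
    then show ?thesis by (rule span_scaleD) (simp add: Lpq del: to_fract_mult)
  next
    case False
    \<comment> \<open>The graph is a star pointing at \<open>q\<close>. The columns \<open>K\<^sub>p\<^sub>p, K\<^sub>r\<^sub>r, K\<^sub>p\<^sub>r\<close> only meet the rows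
      \<open>\<lambda>\<^sub>p\<^sub>q, \<lambda>\<^sub>r\<^sub>q, s\<close>, and Cramer's rule for this 3 by 3 system gives the coefficients below.\<close>
    then have rq: "(r, q) \<in> D" using r by auto
    \<comment> \<open>Any other child \<open>l\<close> of \<open>m\<close> would itself be a parent
      of \<open>q\<close> and close a transitive triangle.\<close>
    have ch: "(m, l) \<in> D \<longleftrightarrow> l = q" if "m \<in> V" "m \<noteq> q" for m l
      using transitive_triangle_freeD[OF D(3), of m l q] that False digraphD(4)[OF D(1)] by blast
    define x y where "x = ?L p q" and "y = ?L r q"
    have x: "x = Var (Some (p, q))" and y: "y = Var (Some (r, q))"
      using pq rq by (simp_all add: x_def y_def Lam_def)
    have L: "?L p l = (if l = q then x else 0)" "?L r l = (if l = q then y else 0)" for l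
      using ch p r by (auto simp: x_def y_def Lam_def)
    have if_mult: "(if P then a else 0) * (if P then b else 0) = (if P then a * b else 0)"
      for P and a b :: "'a mpoly" by simp
    have relation3: "2 * (x * x + y * y) * jac_entry V D \<theta> (p, q) =
        - (x * (1 + y * y)) * jac_entry V D \<theta> (p, p) + x * (1 - x * x) * jac_entry V D \<theta> (r, r)
        - 2 * y * (1 - x * x) * jac_entry V D \<theta> (p, r)" for \<theta>
    proof (cases \<theta>)
      case None
      have "jac_entry V D \<theta> (p, r) = x * y"
        using p q r fin by (simp add: None jac_entry_scale sum_IminusLam L if_mult)
      moreover have "jac_entry V D \<theta> (p, p) = 1 + x * x" "jac_entry V D \<theta> (r, r) = 1 + y * y"
        using p q r fin by (simp_all add: None jac_entry_diag[OF D(1)] L if_mult)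
      moreover have "jac_entry V D \<theta> (p, q) = - x"
        by (simp add: None jac_entry_of_edge[OF D pq] x_def)
      ultimately show ?thesis by (simp add: algebra_simps)
    next
      case (Some e)
      obtain a b where e: "e = (a, b)" by (cases e)
      consider "e = (p, q)" | "e = (r, q)" | "(a, b) \<notin> D \<or> a \<noteq> p \<and> a \<noteq> r"
        using ch p r e by blast
      then show ?thesis
      proof cases
        case 1
        then have "jac_entry V D \<theta> (p, r) = Var None * y"
          using pq r p by (simp add: Some jac_entry_edge[OF digraphD(1,2)[OF D(1)]] IminusLam_def L)
        moreover have "jac_entry V D \<theta> (p, q) = - Var None"
          using 1 by (simp add: Some jac_entry_of_edge[OF D pq])
        moreover have "jac_entry V D \<theta> (p, p) = 2 * Var None * x" "jac_entry V D \<theta> (r, r) = 0"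
          using 1 p r by (simp_all add: Some jac_entry_diag[OF D(1)] L)
        ultimately show ?thesis by (simp add: algebra_simps)
      next
        case 2
        then have "jac_entry V D \<theta> (p, r) = Var None * x"
          using rq r p by (simp add: Some jac_entry_edge[OF digraphD(1,2)[OF D(1)]] IminusLam_def L)
        moreover have "jac_entry V D \<theta> (p, q) = 0"
          using 2 r by (simp add: Some jac_entry_of_edge[OF D pq])
        moreover have "jac_entry V D \<theta> (r, r) = 2 * Var None * y" "jac_entry V D \<theta> (p, p) = 0"
          using 2 p r by (simp_all add: Some jac_entry_diag[OF D(1)] L)
        ultimately show ?thesis by (simp add: algebra_simps)
      next
        case 3
        then have "jac_entry V D \<theta> c = 0" if "c \<in> {(p, p), (r, r), (p, r)}" for c
          using that unfolding Some e
          by (elim disjE) (auto simp: jac_entry_edge[OF digraphD(1,2)[OF D(1)]])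
        moreover have "jac_entry V D \<theta> (p, q) = 0"
          using 3 pq by (auto simp: Some e jac_entry_of_edge[OF D pq])
        ultimately show ?thesis by simp
      qed
    qed
    have relation3': "to_fract (2 * (x * x + y * y)) * to_fract (jac_entry V D \<theta> (p, q)) =
        to_fract (- (x * (1 + y * y))) * to_fract (jac_entry V D \<theta> (p, p))
        + to_fract (x * (1 - x * x)) * to_fract (jac_entry V D \<theta> (r, r))
        - to_fract (2 * y * (1 - x * x)) * to_fract (jac_entry V D \<theta> (p, r))" for \<theta>
      by (simp only: relation3 flip: to_fract_mult to_fract_add to_fract_diff)
    have "(\<lambda>\<theta>. to_fract (2 * (x * x + y * y)) * ?col (p, q) \<theta>) =
       (\<lambda>\<theta>. to_fract (- (x * (1 + y * y))) * ?col (p, p) \<theta>)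
       + (\<lambda>\<theta>. to_fract (x * (1 - x * x)) * ?col (r, r) \<theta>)
       - (\<lambda>\<theta>. to_fract (2 * y * (1 - x * x)) * ?col (p, r) \<theta>)"
      unfolding fun_eq_iff plus_fun_apply fun_diff_def jac_col_def relation3' by (intro allI refl)
    also have "\<dots> \<in> ?W"
      by (intro fun_space.span_add fun_space.span_diff fun_space.span_scale base p r)
    finally show ?thesis
    proof (rule span_scaleD)
      \<comment> \<open>Up to the factor \<open>- s^2\<close> this is the determinant of the 3 by 3
        system.\<close>
      show "to_fract (2 * (x * x + y * y)) \<noteq> 0"
        unfolding to_fract_eq_0_iff x y mult_eq_0_iff
        using Var_sq_add_Var_sq_neq_0[of "Some (p, q)" "Some (r, q)"] by simp
    qed
  qed
qed

section \<open>Comparison of the two matroids\<close>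

text \<open>For \<open>D1\<close> the column \<open>K_pq\<close> is nonzero and in the closure of
  the columns avoiding \<open>q\<close>. For \<open>D2\<close> it is either outside that closure,
  detected by a row of an edge leaving \<open>q\<close>, or a loop.\<close>

lemma edge_not_in_imp_matroid_neq:
  fixes V :: "'a::linorder set"
  assumes D1: "digraph V D1" "simple_digraph D1" "transitive_triangle_free D1"
    and nc: "\<not> complete_digraph V D1"
    and D2: "digraph V D2"
    and pq: "(p, q) \<in> D1" "(p, q) \<notin> D2"
  shows "jacobian_matroid V D1 \<noteq> jacobian_matroid V D2"
proof
  assume "jacobian_matroid V D1 = jacobian_matroid V D2"
  then have same: "jac_indep V D1 S \<longleftrightarrow> jac_indep V D2 S" for S
    by (auto simp: jacobian_matroid_def)
  note V1 = digraphD(1,2)[OF D1(1)] and V2 = digraphD(1,2)[OF D2]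
  have p: "p \<in> V" "p \<noteq> q" and q: "q \<in> V" using digraphD(4)[OF D1(1) pq(1)] by auto
  \<comment> \<open>Column indices are increasing pairs, while the edge may point either way in the
    order.\<close>
  define c where "c = (min p q, max p q)"
  have c: "c \<in> jac_cols V" using p q by (auto simp: c_def jac_cols_def min_def max_def)
  have entry_c: "jac_entry V D \<theta> c = jac_entry V D \<theta> (p, q)" for D \<theta>
    using jac_entry_commute[of V D \<theta> q p] by (simp add: c_def min_def max_def)
  have col_c: "jac_col V D1 c = jac_col V D1 (p, q)"
    by (simp add: fun_eq_iff jac_col_def entry_c)
  \<comment> \<open>Without a third node the edge from \<open>p\<close> to \<open>q\<close> alone
    would make \<open>D1\<close> complete.\<close>
  obtain r where r: "r \<in> V" "r \<noteq> p" "r \<noteq> q"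
    using nc pq(1) by (auto simp: complete_digraph_def adjacent_def)
  have indep_empty: "jac_indep V D {}" for D by (simp add: jac_indep_def)
  show False
  \<comment> \<open>Such an \<open>l\<close> is exactly what makes the entry of \<open>K_pq\<close>
    in row \<open>Some (q, l)\<close> nonzero; that row vanishes on all columns avoiding
    \<open>q\<close>.\<close>
  proof (cases "\<exists>l. (q, l) \<in> D2 \<and> (l = p \<or> (p, l) \<in> D2)")
    case True
    then obtain l where l: "(q, l) \<in> D2" "l = p \<or> (p, l) \<in> D2" by auto
    let ?A = "{c \<in> jac_cols V. fst c \<noteq> q \<and> snd c \<noteq> q}"
    obtain S where S: "S \<subseteq> ?A" "jac_indep V D1 S" "\<not> jac_indep V D1 (insert c S)"
    proof (rule jac_span_imp_dependent[OF V1 _ c])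
      show "c \<notin> ?A" by (auto simp: c_def min_def max_def)
      show "jac_col V D1 c \<in> fun_space.span (jac_col V D1 ` ?A)"
        unfolding col_c by (rule jac_col_edge_in_span[OF D1 pq(1) r])
    qed auto
    have "jac_indep V D2 (insert c S)"
    proof (rule jac_indep_insert[OF _ _ c])
      show "jac_indep V D2 S" using S same by simp
      show "finite S"
        by (rule finite_subset[of _ "V \<times> V"]) (use S V1 in \<open>auto simp: jac_cols_def\<close>)
      show "Some (q, l) \<in> jac_rows D2" using l by (simp add: jac_rows_def)
      show "jac_entry V D2 (Some (q, l)) c \<noteq> 0"
        using l p digraphD(3)[OF D2]
        by (auto simp: entry_c jac_entry_edge[OF V2] IminusLam_def Lam_def)
      show "jac_entry V D2 (Some (q, l)) d = 0" if "d \<in> S" for d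
        using that S(1) by (cases d) (auto simp: jac_entry_edge[OF V2])
    qed
    with S same show False by simp
  next
    case False
    \<comment> \<open>Now \<open>K_pq\<close> vanishes identically for \<open>D2\<close>, so
      \<open>c\<close> is a loop there but not for \<open>D1\<close>.\<close>
    have "jac_indep V D1 {c}"
    proof (rule jac_indep_insert[OF indep_empty _ c])
      show "None \<in> jac_rows D1" by (simp add: jac_rows_def)
      show "jac_entry V D1 None c \<noteq> 0"
        using pq by (simp add: entry_c jac_entry_of_edge[OF D1 pq(1)] Lam_def)
    qed auto
    moreover have "jac_entry V D2 \<theta> (p, q) = 0" for \<theta>
    proof (cases \<theta>)
      case None
      have "(\<Sum>k\<in>V. Lam D2 p k * Lam D2 q k) = 0"
        by (rule sum.neutral) (use False in \<open>auto simp: Lam_def\<close>)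
      moreover have "Lam D2 p q = 0" "Lam D2 q p = 0" using False pq by (auto simp: Lam_def)
      ultimately show ?thesis
        using None p q V2 by (simp add: jac_entry_scale sum_IminusLam)
    next
      case (Some e)
      then show ?thesis using False pq p
        by (cases e) (auto simp: jac_entry_edge[OF V2] IminusLam_def Lam_def)
    qed
    then have "\<not> jac_indep V D2 {c}"
      by (auto simp: jac_indep_def entry_c simp flip: Zero_fract_def intro!: exI[of _ "\<lambda>_. 1"])
    ultimately show False using same by simp
  qed
qed

theorem theorem4p8:
  fixes V :: "'a::linorder set" and D1 D2 :: "('a \<times> 'a) set"
  assumes "digraph V D1" and "digraph V D2"
    and "D1 \<noteq> D2"
    and "simple_digraph D1" and "simple_digraph D2"
    and "\<not> complete_digraph V D1" and "\<not> complete_digraph V D2"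
    and "transitive_triangle_free D1" and "transitive_triangle_free D2"
  shows "jacobian_matroid V D1 \<noteq> jacobian_matroid V D2"
proof -
  \<comment> \<open>The claim is symmetric in the two graphs, so an edge in either difference
    suffices.\<close>
  from \<open>D1 \<noteq> D2\<close> obtain p q where "(p, q) \<in> D1 \<and> (p, q) \<notin> D2 \<or> (p, q) \<in> D2 \<and> (p, q) \<notin> D1"
    by auto
  then show ?thesis
    using edge_not_in_imp_matroid_neq[of V D1 D2 p q] edge_not_in_imp_matroid_neq[of V D2 D1 p q]
      assms by metis
qed

end
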